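(* Let $p\geq 5$ be a prime, $H=\langle a,b: a^4=b^2=e,\ a^b=a^{-1}\rangle\cong D_8$, $C=\langle c\rangle$ a cyclic group of order $p$, and $G=H\times C$. Let $\mathcal{S}$ be the partition of $G$ into the sets $$Z_0=\{e\},\ Z_1=\{a^2\},\ Z_2=\{ab\},\ Z_3=\{a^3b\},\ Z_4=\{a,a^3,b,a^2b\},$$ $$X_1=c\{e,a^2\},\ X_2=c\{ab,a^3b\},\ X_3=c\{a,b\},\ X_4=c\{a^3,a^2b\},$$ $$Y_1=c^{-1}\{e,a^2\},\ Y_2=c^{-1}\{ab,a^3b\},\ Y_3=c^{-1}\{a^3,b\},\ Y_4=c^{-1}\{a,a^2b\},$$ $$T_{1k}=c^k\{e,a^2\},\ T_{2k}=c^k\{ab,a^3b\},\ T_{3k}=c^k\{a,a^3,b,a^2b\},\quad k\in\{2,\ldots,p-2\}.$$ Then the $\mathbb{Z}$-module $\mathcal{A}=\mathrm{Span}_{\mathbb{Z}}\{\underline{X}:X\in\mathcal{S}\}$ is an S-ring over $G$.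
   Context: Here $a^b=b^{-1}ab$. For a finite group $G$ with identity $e$ and $X\subseteq G$ put $\underline{X}=\sum_{x\in X}x\in\mathbb{Z}G$ and $X^{-1}=\{x^{-1}:x\in X\}$. A subring $\mathcal{A}\subseteq\mathbb{Z}G$ is an S-ring over $G$ if there is a partition $\mathcal{S}$ of $G$ such that (1) $\{e\}\in\mathcal{S}$; (2) $X\in\mathcal{S}$ implies $X^{-1}\in\mathcal{S}$; (3) $\mathcal{A}=\mathrm{Span}_{\mathbb{Z}}\{\underline{X}:X\in\mathcal{S}\}$. *)

theory Defs
  imports
    "HOL-Algebra.Subrings"
    "HOL-Algebra.Generated_Groups"
    "HOL-Computational_Algebra.Primes"
    "HOL-Library.Disjoint_Sets"
begin

text \<open>
  An element of the integral group ring of a finite group is represented by its coefficient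
  function, extended by zero outside the carrier; multiplication is convolution.  The sum in
  the product is only meaningful because the carrier is finite.
\<close>

definition group_ring :: "('a, 'm) monoid_scheme \<Rightarrow> ('a \<Rightarrow> int) ring" where
  "group_ring G =
    \<lparr>carrier = {f. \<forall>x. x \<notin> carrier G \<longrightarrow> f x = 0},
     monoid.mult = (\<lambda>f g x. if x \<in> carrier G
        then (\<Sum>y\<in>carrier G. f y * g (inv\<^bsub>G\<^esub> y \<otimes>\<^bsub>G\<^esub> x)) else 0),
     one = (\<lambda>x. if x = \<one>\<^bsub>G\<^esub> then 1 else 0),
     zero = (\<lambda>x. 0),
     add = (\<lambda>f g x. f x + g x)\<rparr>"

definition group_elem :: "'a \<Rightarrow> 'a \<Rightarrow> int" where
  "group_elem x = (\<lambda>g. if g = x then 1 else 0)"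

definition simple_quantity :: "'a set \<Rightarrow> 'a \<Rightarrow> int" where
  "simple_quantity X = (\<lambda>g. \<Sum>x\<in>X. group_elem x g)"

definition int_span :: "('a \<Rightarrow> int) set \<Rightarrow> ('a \<Rightarrow> int) set" where
  "int_span B = {(\<lambda>g. \<Sum>v\<in>T. m v * v g) | T m. finite T \<and> T \<subseteq> B}"

definition S_ring :: "('a, 'm) monoid_scheme \<Rightarrow> ('a \<Rightarrow> int) set \<Rightarrow> bool" where
  "S_ring G A \<longleftrightarrow>
     subring A (group_ring G) \<and>
     (\<exists>S. partition_on (carrier G) S \<and>
          {\<one>\<^bsub>G\<^esub>} \<in> S \<and>
          (\<forall>X\<in>S. (\<lambda>x. inv\<^bsub>G\<^esub> x) ` X \<in> S) \<and>
          A = int_span (simple_quantity ` S))"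

text \<open>
  In the direct product, the set \<open>x U\<close> for \<open>x\<close> in \<open>C\<close> and \<open>U\<close> a subset of \<open>H\<close> is \<open>U \<times> {x}\<close>.
\<close>

definition basic_sets ::
  "('h, 'm) monoid_scheme \<Rightarrow> 'h \<Rightarrow> 'h \<Rightarrow> ('c, 'n) monoid_scheme \<Rightarrow> 'c \<Rightarrow> nat \<Rightarrow> ('h \<times> 'c) set set"
where
  "basic_sets H a b C c p =
    (let e = \<one>\<^bsub>H\<^esub>;
         a2 = a [^]\<^bsub>H\<^esub> (2::nat);
         a3 = a [^]\<^bsub>H\<^esub> (3::nat);
         ab = a \<otimes>\<^bsub>H\<^esub> b;
         a2b = a2 \<otimes>\<^bsub>H\<^esub> b;
         a3b = a3 \<otimes>\<^bsub>H\<^esub> b;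
         c' = inv\<^bsub>C\<^esub> c
     in {{e} \<times> {\<one>\<^bsub>C\<^esub>}, {a2} \<times> {\<one>\<^bsub>C\<^esub>}, {ab} \<times> {\<one>\<^bsub>C\<^esub>}, {a3b} \<times> {\<one>\<^bsub>C\<^esub>},
           {a, a3, b, a2b} \<times> {\<one>\<^bsub>C\<^esub>}}
      \<union> {{e, a2} \<times> {c}, {ab, a3b} \<times> {c}, {a, b} \<times> {c}, {a3, a2b} \<times> {c}}
      \<union> {{e, a2} \<times> {c'}, {ab, a3b} \<times> {c'}, {a3, b} \<times> {c'}, {a, a2b} \<times> {c'}}
      \<union> (\<Union>k\<in>{2..p - 2}.
           {{e, a2} \<times> {c [^]\<^bsub>C\<^esub> k},
            {ab, a3b} \<times> {c [^]\<^bsub>C\<^esub> k},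
            {a, a3, b, a2b} \<times> {c [^]\<^bsub>C\<^esub> k}}))"

lemma group_ring_is_ring:
  fixes G (structure)
  assumes "group G" and fin: "finite (carrier G)"
  shows "ring (group_ring G)"
proof -
  interpret group G by fact
  have shift: "(\<Sum>y\<in>carrier G. F (inv z \<otimes> y)) = (\<Sum>y\<in>carrier G. F y)"
    if "z \<in> carrier G" for z and F :: "'a \<Rightarrow> int"
    by (rule sum.reindex_bij_witness[of _ "\<lambda>y. z \<otimes> y" "\<lambda>y. inv z \<otimes> y"])
       (use that in \<open>auto simp: m_assoc[symmetric]\<close>)
  show ?thesis
  proof (rule ringI)
    show "abelian_group (group_ring G)"
    proof (rule abelian_groupI)
      fix f assume "f \<in> carrier (group_ring G)"
      then show "\<exists>g\<in>carrier (group_ring G). g \<oplus>\<^bsub>group_ring G\<^esub> f = \<zero>\<^bsub>group_ring G\<^esub>"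
        by (intro bexI[of _ "\<lambda>x. - f x"]) (auto simp: group_ring_def)
    qed (auto simp: group_ring_def)
  next
    show "Group.monoid (group_ring G)"
    proof (rule monoidI)
      fix f g h :: "'a \<Rightarrow> int"
      have "(\<Sum>y\<in>carrier G. (\<Sum>z\<in>carrier G. f z * g (inv z \<otimes> y)) * h (inv y \<otimes> x)) =
            (\<Sum>z\<in>carrier G. f z * (\<Sum>y\<in>carrier G. g y * h (inv y \<otimes> (inv z \<otimes> x))))"
        if x: "x \<in> carrier G" for x
      proof -
        have "(\<Sum>y\<in>carrier G. (\<Sum>z\<in>carrier G. f z * g (inv z \<otimes> y)) * h (inv y \<otimes> x)) =
              (\<Sum>z\<in>carrier G. f z * (\<Sum>y\<in>carrier G. g (inv z \<otimes> y) * h (inv y \<otimes> x)))"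
          by (simp add: sum_distrib_left sum_distrib_right mult.assoc, rule sum.swap)
        also have "\<dots> = (\<Sum>z\<in>carrier G. f z * (\<Sum>y\<in>carrier G. g y * h (inv y \<otimes> (inv z \<otimes> x))))"
        proof (rule sum.cong[OF refl], rule arg_cong[where f = "(*) _"])
          fix z assume z: "z \<in> carrier G"
          have "inv y \<otimes> x = inv (inv z \<otimes> y) \<otimes> (inv z \<otimes> x)" if y: "y \<in> carrier G" for y
          proof -
            have "z \<otimes> (inv z \<otimes> x) = x"
              using x z by (simp add: m_assoc[symmetric])
            then show ?thesis using x y z by (simp add: inv_mult_group m_assoc)
          qed
          then have "(\<Sum>y\<in>carrier G. g (inv z \<otimes> y) * h (inv y \<otimes> x)) =
              (\<Sum>y\<in>carrier G. g (inv z \<otimes> y) * h (inv (inv z \<otimes> y) \<otimes> (inv z \<otimes> x)))"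
            by (intro sum.cong) auto
          also have "\<dots> = (\<Sum>y\<in>carrier G. g y * h (inv y \<otimes> (inv z \<otimes> x)))"
            using shift[OF z, of "\<lambda>y. g y * h (inv y \<otimes> (inv z \<otimes> x))"] .
          finally show "(\<Sum>y\<in>carrier G. g (inv z \<otimes> y) * h (inv y \<otimes> x)) =
              (\<Sum>y\<in>carrier G. g y * h (inv y \<otimes> (inv z \<otimes> x)))" .
        qed
        finally show ?thesis .
      qed
      then show "f \<otimes>\<^bsub>group_ring G\<^esub> g \<otimes>\<^bsub>group_ring G\<^esub> h =
          f \<otimes>\<^bsub>group_ring G\<^esub> (g \<otimes>\<^bsub>group_ring G\<^esub> h)"
        by (auto simp: group_ring_def fun_eq_iff)
    next
      fix f assume f: "f \<in> carrier (group_ring G)"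
      have "(\<Sum>y\<in>carrier G. (if y = \<one> then 1 else 0) * f (inv y \<otimes> x)) = f x"
        if "x \<in> carrier G" for x
        using that fin by (simp add: if_distrib[of "\<lambda>u. u * _"] cong: if_cong)
      then show "\<one>\<^bsub>group_ring G\<^esub> \<otimes>\<^bsub>group_ring G\<^esub> f = f"
        using f by (auto simp: group_ring_def fun_eq_iff)
      have "(\<Sum>y\<in>carrier G. f y * (if inv y \<otimes> x = \<one> then 1 else 0)) = f x"
        if x: "x \<in> carrier G" for x
      proof -
        have "inv y \<otimes> x = \<one> \<longleftrightarrow> y = x" if "y \<in> carrier G" for y
          using that x by (metis inv_closed inv_equality inv_inv l_inv)
        then have "(\<Sum>y\<in>carrier G. f y * (if inv y \<otimes> x = \<one> then 1 else 0)) =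
            (\<Sum>y\<in>carrier G. if y = x then f y else 0)"
          by (intro sum.cong) auto
        then show ?thesis using x fin by simp
      qed
      then show "f \<otimes>\<^bsub>group_ring G\<^esub> \<one>\<^bsub>group_ring G\<^esub> = f"
        using f by (auto simp: group_ring_def fun_eq_iff)
    qed (auto simp: group_ring_def)
  qed (auto simp: group_ring_def fun_eq_iff algebra_simps sum.distrib)
qed

end

theory Submission
  imports Defs "HOL-Algebra.Multiplicative_Group"
begin

text \<open>
  The span of a partition consists of the functions that are constant on its blocks.  Here every
  block lies in a fibre \<open>H \<times> {x}\<close>, so the span is a direct sum of submodules \<open>M x\<close> of the group
  ring of \<open>H\<close>, and it is closed under multiplication as soon as \<open>M x M y \<subseteq> M (x y)\<close>.  The
  submodule \<open>N\<close> belonging to \<open>c\<^sup>k\<close> with \<open>2 \<le> k \<le> p - 2\<close> is contained in all the others and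
  absorbs multiplication by them, and it also contains \<open>M c M c\<close> and \<open>M c\<^sup>-\<^sup>1 M c\<^sup>-\<^sup>1\<close>.  What is left
  are products involving \<open>M e\<close> and the products of \<open>M c\<close> with \<open>M c\<^sup>-\<^sup>1\<close>, which are checked in
  coordinates.
\<close>

section \<open>Spans of partitions as functions constant on blocks\<close>

definition block_const :: "'a set set \<Rightarrow> ('a \<Rightarrow> int) \<Rightarrow> bool" where
  "block_const S f \<longleftrightarrow> (\<forall>U\<in>S. \<forall>u\<in>U. \<forall>v\<in>U. f u = f v)"

lemma block_const_map:
  assumes "block_const S f" "block_const S g"
  shows "block_const S (\<lambda>x. \<phi> (f x) (g x))"
  unfolding block_const_def
  by (intro ballI arg_cong2[where f = \<phi>]) (use assms in \<open>unfold block_const_def, blast+\<close>)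

lemma simple_quantity_eq_indicator:
  "finite X \<Longrightarrow> simple_quantity X g = (if g \<in> X then 1 else 0)"
  by (simp add: simple_quantity_def group_elem_def)

text \<open>Blocks are disjoint, so the indicator of one block is constant on every block.
  Conversely, a function constant on the blocks is the combination of their indicators whose
  coefficients are its values there.\<close>

lemma int_span_simple_quantity:
  assumes S: "partition_on A S" and A: "finite A"
  shows "int_span (simple_quantity ` S) = {f. (\<forall>x. x \<notin> A \<longrightarrow> f x = 0) \<and> block_const S f}"
proof (intro equalityI subsetI)
  have fin: "finite X" if "X \<in> S" for X
    using that S A by (metis Sup_upper finite_subset partition_onD1)
  note sq = simple_quantity_eq_indicator[OF fin]
  fix f assume "f \<in> int_span (simple_quantity ` S)"
  then obtain T m where T: "T \<subseteq> simple_quantity ` S" and f: "f = (\<lambda>g. \<Sum>v\<in>T. m v * v g)"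
    by (auto simp: int_span_def)
  have "v g = 0" if "v \<in> T" "g \<notin> A" for v g
    using that T S by (auto simp: sq dest!: subsetD partition_onD1)
  moreover have "v g = v h" if "v \<in> T" "U \<in> S" "g \<in> U" "h \<in> U" for v U g h
  proof -
    obtain X where X: "X \<in> S" "v = simple_quantity X" using T \<open>v \<in> T\<close> by auto
    have "g \<in> X \<longleftrightarrow> h \<in> X"
      using X that partition_onD2[OF S] by (auto simp: disjoint_def)
    then show ?thesis using X by (simp add: sq)
  qed
  ultimately show "f \<in> {f. (\<forall>x. x \<notin> A \<longrightarrow> f x = 0) \<and> block_const S f}"
    by (auto simp: f block_const_def intro!: sum.neutral sum.cong)
next
  have fin: "finite X" if "X \<in> S" for X
    using that S A by (metis Sup_upper finite_subset partition_onD1)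
  note sq = simple_quantity_eq_indicator[OF fin]
  fix f assume "f \<in> {f. (\<forall>x. x \<notin> A \<longrightarrow> f x = 0) \<and> block_const S f}"
  then have f0: "\<And>x. x \<notin> A \<Longrightarrow> f x = 0"
    and fc: "\<And>U u v. U \<in> S \<Longrightarrow> u \<in> U \<Longrightarrow> v \<in> U \<Longrightarrow> f u = f v"
    unfolding block_const_def by blast+
  define m where "m v = f (SOME g. v g = (1::int))" for v
  let ?T = "simple_quantity ` S"
  have "finite S" using finite_elements[OF A S] .
  have "f g = (\<Sum>v\<in>?T. m v * v g)" for g
  proof (cases "g \<in> A")
    case False
    then have "(\<Sum>v\<in>?T. m v * v g) = 0"
      using S by (intro sum.neutral) (auto simp: sq dest!: partition_onD1)
    then show ?thesis using False f0 by simp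
  next
    case True
    then obtain U where U: "U \<in> S" "g \<in> U" using S by (auto dest!: partition_onD1)
    have "(\<Sum>v\<in>?T. m v * v g) = (\<Sum>v\<in>{simple_quantity U}. m v * v g)"
    proof (rule sum.mono_neutral_right)
      show "\<forall>v\<in>?T - {simple_quantity U}. m v * v g = 0"
      proof
        fix v assume "v \<in> ?T - {simple_quantity U}"
        then obtain X where X: "X \<in> S" "v = simple_quantity X" "X \<noteq> U" by auto
        then have "g \<notin> X" using U partition_onD2[OF S] by (auto simp: disjoint_def)
        then show "m v * v g = 0" using X by (simp add: sq)
      qed
    qed (use \<open>finite S\<close> U in auto)
    also have "\<dots> = m (simple_quantity U)" using U by (simp add: sq)
    also have "\<dots> = f g"
    proof -
      have "simple_quantity U (SOME h. simple_quantity U h = 1) = 1"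
        by (rule someI[of _ g]) (use U in \<open>simp add: sq\<close>)
      then show ?thesis unfolding m_def using U
        by (intro fc[of U]) (auto simp: sq split: if_splits)
    qed
    finally show ?thesis by simp
  qed
  then have "f = (\<lambda>g. \<Sum>v\<in>?T. m v * v g)" ..
  then show "f \<in> int_span ?T"
    using \<open>finite S\<close> unfolding int_span_def by blast
qed

section \<open>Fibrewise S-rings over a direct product\<close>

text \<open>Sorting the convolution by the \<open>C\<close>-coordinate of the left factor leaves
  convolutions over \<open>H\<close> only. This is what reduces closure under products to a
  statement about pairs of fibres.\<close>

lemma group_ring_mult_DirProd:
  assumes "group H" "group C" "h \<in> carrier H" "x \<in> carrier C"
  shows "(f \<otimes>\<^bsub>group_ring (H \<times>\<times> C)\<^esub> g) (h, x) =
    (\<Sum>y\<in>carrier C.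
      ((\<lambda>k. f (k, y)) \<otimes>\<^bsub>group_ring H\<^esub> (\<lambda>k. g (k, inv\<^bsub>C\<^esub> y \<otimes>\<^bsub>C\<^esub> x))) h)"
proof -
  have "(f \<otimes>\<^bsub>group_ring (H \<times>\<times> C)\<^esub> g) (h, x) =
      (\<Sum>(k, y)\<in>carrier H \<times> carrier C.
        f (k, y) * g (inv\<^bsub>H\<^esub> k \<otimes>\<^bsub>H\<^esub> h, inv\<^bsub>C\<^esub> y \<otimes>\<^bsub>C\<^esub> x))"
    using assms by (auto simp: group_ring_def inv_DirProd intro!: sum.cong)
  also have "\<dots> = (\<Sum>k\<in>carrier H. \<Sum>y\<in>carrier C.
        f (k, y) * g (inv\<^bsub>H\<^esub> k \<otimes>\<^bsub>H\<^esub> h, inv\<^bsub>C\<^esub> y \<otimes>\<^bsub>C\<^esub> x))"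
    by (simp add: sum.cartesian_product)
  also have "\<dots> = (\<Sum>y\<in>carrier C. \<Sum>k\<in>carrier H.
        f (k, y) * g (inv\<^bsub>H\<^esub> k \<otimes>\<^bsub>H\<^esub> h, inv\<^bsub>C\<^esub> y \<otimes>\<^bsub>C\<^esub> x))"
    by (rule sum.swap)
  finally show ?thesis using assms by (simp add: group_ring_def)
qed

lemma partition_on_fibrewise:
  assumes "\<And>x. x \<in> B \<Longrightarrow> partition_on A (P x)"
  shows "partition_on (A \<times> B) (\<Union>x\<in>B. (\<lambda>U. U \<times> {x}) ` P x)"
proof (rule partition_onI)
  show "\<Union> (\<Union>x\<in>B. (\<lambda>U. U \<times> {x}) ` P x) = A \<times> B"
  proof (intro equalityI subsetI)
    fix z assume "z \<in> \<Union> (\<Union>x\<in>B. (\<lambda>U. U \<times> {x}) ` P x)"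
    then obtain x U where "x \<in> B" "U \<in> P x" "z \<in> U \<times> {x}" by auto
    moreover from this have "U \<subseteq> A" using partition_onD1[OF assms] by blast
    ultimately show "z \<in> A \<times> B" by auto
  next
    fix z assume "z \<in> A \<times> B"
    then obtain h x where z: "z = (h, x)" "h \<in> A" "x \<in> B" by auto
    then obtain U where "U \<in> P x" "h \<in> U" using partition_onD1[OF assms] by blast
    then show "z \<in> \<Union> (\<Union>x\<in>B. (\<lambda>U. U \<times> {x}) ` P x)" using z by blast
  qed
next
  fix p q assume "p \<in> (\<Union>x\<in>B. (\<lambda>U. U \<times> {x}) ` P x)" "q \<in> (\<Union>x\<in>B. (\<lambda>U. U \<times> {x}) ` P x)" "p \<noteq> q"
  then obtain x y U V where *: "x \<in> B" "U \<in> P x" "p = U \<times> {x}" "y \<in> B" "V \<in> P y" "q = V \<times> {y}"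
    by auto
  show "disjnt p q"
  proof (cases "x = y")
    case True
    then have "U \<inter> V = {}"
      using * \<open>p \<noteq> q\<close> partition_onD2[OF assms[of x]] by (auto simp: disjoint_def)
    then show ?thesis using * by (auto simp: disjnt_def)
  qed (use * in \<open>auto simp: disjnt_def\<close>)
next
  show "{} \<notin> (\<Union>x\<in>B. (\<lambda>U. U \<times> {x}) ` P x)"
  proof
    assume "{} \<in> (\<Union>x\<in>B. (\<lambda>U. U \<times> {x}) ` P x)"
    then obtain x U where "x \<in> B" "U \<in> P x" "U \<times> {x} = {}"
      unfolding UN_iff image_iff by metis
    then show False using partition_onD3[OF assms] by auto
  qed
qed

text \<open>The fibre of a product over \<open>x\<close> is a sum of products of a fibre over
  \<open>y\<close> with one over \<open>inv y\<close> times \<open>x\<close>. By \<open>mult\<close>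
  every summand is constant on the blocks of \<open>P x\<close>, hence so is the sum.\<close>

lemma S_ring_fibrewise:
  fixes H :: "('h, 'm) monoid_scheme" and C :: "('c, 'n) monoid_scheme"
  assumes H: "group H" "finite (carrier H)" and C: "group C" "finite (carrier C)"
    and part: "\<And>x. x \<in> carrier C \<Longrightarrow> partition_on (carrier H) (P x)"
    and one: "{\<one>\<^bsub>H\<^esub>} \<in> P \<one>\<^bsub>C\<^esub>"
    and inv: "\<And>x U. x \<in> carrier C \<Longrightarrow> U \<in> P x \<Longrightarrow> (\<lambda>h. inv\<^bsub>H\<^esub> h) ` U \<in> P (inv\<^bsub>C\<^esub> x)"
    and mult: "\<And>x y f g. x \<in> carrier C \<Longrightarrow> y \<in> carrier C \<Longrightarrow>
      block_const (P x) f \<Longrightarrow> block_const (P y) g \<Longrightarrow>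
      block_const (P (x \<otimes>\<^bsub>C\<^esub> y)) (f \<otimes>\<^bsub>group_ring H\<^esub> g)"
  defines "S \<equiv> \<Union>x\<in>carrier C. (\<lambda>U. U \<times> {x}) ` P x"
  shows "S_ring (H \<times>\<times> C) (int_span (simple_quantity ` S))"
proof -
  interpret H: group H by fact
  interpret C: group C by fact
  let ?G = "H \<times>\<times> C"
  have G: "group ?G" using H.group_axioms C.group_axioms by (rule DirProd_group)
  have fin: "finite (carrier ?G)" using H C by (simp add: DirProd_def)
  interpret R: ring "group_ring ?G" using G fin by (rule group_ring_is_ring)
  have S: "partition_on (carrier ?G) S"
    using partition_on_fibrewise[OF part] by (simp add: S_def DirProd_def)
  have span: "int_span (simple_quantity ` S) =
      {f \<in> carrier (group_ring ?G). block_const S f}" (is "_ = ?A")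
    using int_span_simple_quantity[OF S fin] by (simp add: group_ring_def)
  have block_const_S: "block_const S f \<longleftrightarrow> (\<forall>x\<in>carrier C. block_const (P x) (\<lambda>h. f (h, x)))"
    for f by (auto simp: block_const_def S_def)
  have one_S: "{\<one>\<^bsub>?G\<^esub>} \<in> S"
    using one by (force simp: S_def)
  have "subring ?A (group_ring ?G)"
  proof (rule R.subringI)
    \<comment> \<open>The unit of the group ring is the indicator of the identity. It is constant on
      blocks because the block containing the identity is a singleton.\<close>
    have "\<one>\<^bsub>?G\<^esub> \<in> U \<Longrightarrow> U \<in> S \<Longrightarrow> U = {\<one>\<^bsub>?G\<^esub>}" for U
      using disjointD[OF partition_onD2[OF S], of U "{\<one>\<^bsub>?G\<^esub>}"] one_S by auto
    then have "block_const S \<one>\<^bsub>group_ring ?G\<^esub>"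
      by (auto simp: group_ring_def block_const_def)
    then show "\<one>\<^bsub>group_ring ?G\<^esub> \<in> ?A" by auto
  next
    fix f assume f: "f \<in> ?A"
    have "\<ominus>\<^bsub>group_ring ?G\<^esub> f = (\<lambda>x. - f x)"
      by (rule R.minus_equality) (use f in \<open>auto simp: group_ring_def\<close>)
    then have "block_const S (\<ominus>\<^bsub>group_ring ?G\<^esub> f)"
      using f block_const_map[of S f f "\<lambda>x _. - x"] by simp
    then show "\<ominus>\<^bsub>group_ring ?G\<^esub> f \<in> ?A" using f by simp
  next
    fix f g assume f: "f \<in> ?A" and g: "g \<in> ?A"
    have "f \<oplus>\<^bsub>group_ring ?G\<^esub> g = (\<lambda>x. f x + g x)" by (simp add: group_ring_def)
    then have "block_const S (f \<oplus>\<^bsub>group_ring ?G\<^esub> g)"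
      using f g block_const_map[of S f g "(+)"] by simp
    then show "f \<oplus>\<^bsub>group_ring ?G\<^esub> g \<in> ?A" using f g by auto
    have "block_const (P x) (\<lambda>h. (f \<otimes>\<^bsub>group_ring ?G\<^esub> g) (h, x))" if x: "x \<in> carrier C" for x
      unfolding block_const_def
    proof (intro ballI)
      fix U u v assume U: "U \<in> P x" "u \<in> U" "v \<in> U"
      then have uv: "u \<in> carrier H" "v \<in> carrier H"
        using partition_onD1[OF part[OF x]] by auto
      have "((\<lambda>k. f (k, y)) \<otimes>\<^bsub>group_ring H\<^esub> (\<lambda>k. g (k, inv\<^bsub>C\<^esub> y \<otimes>\<^bsub>C\<^esub> x))) u =
            ((\<lambda>k. f (k, y)) \<otimes>\<^bsub>group_ring H\<^esub> (\<lambda>k. g (k, inv\<^bsub>C\<^esub> y \<otimes>\<^bsub>C\<^esub> x))) v"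
        if y: "y \<in> carrier C" for y
      proof -
        have "y \<otimes>\<^bsub>C\<^esub> (inv\<^bsub>C\<^esub> y \<otimes>\<^bsub>C\<^esub> x) = x"
          using x y by (simp add: C.m_assoc[symmetric])
        then have "block_const (P x)
            ((\<lambda>k. f (k, y)) \<otimes>\<^bsub>group_ring H\<^esub> (\<lambda>k. g (k, inv\<^bsub>C\<^esub> y \<otimes>\<^bsub>C\<^esub> x)))"
          using mult[of y "inv\<^bsub>C\<^esub> y \<otimes>\<^bsub>C\<^esub> x"] f g x y by (auto simp: block_const_S)
        then show ?thesis using U unfolding block_const_def by blast
      qed
      then show "(f \<otimes>\<^bsub>group_ring ?G\<^esub> g) (u, x) = (f \<otimes>\<^bsub>group_ring ?G\<^esub> g) (v, x)"
        using uv x by (simp add: group_ring_mult_DirProd[OF H(1) C(1)])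
    qed
    then show "f \<otimes>\<^bsub>group_ring ?G\<^esub> g \<in> ?A" using f g by (auto simp: block_const_S)
  qed auto
  moreover have "(\<lambda>g. inv\<^bsub>?G\<^esub> g) ` X \<in> S" if X: "X \<in> S" for X
  proof -
    obtain x U where xU: "x \<in> carrier C" "U \<in> P x" "X = U \<times> {x}" using X by (auto simp: S_def)
    then have "U \<subseteq> carrier H" using partition_onD1[OF part] by blast
    then have "(\<lambda>g. inv\<^bsub>?G\<^esub> g) ` X = (\<lambda>(h, y). (inv\<^bsub>H\<^esub> h, inv\<^bsub>C\<^esub> y)) ` X"
      using xU by (intro image_cong) (auto simp: inv_DirProd[OF H(1) C(1)])
    also have "\<dots> = ((\<lambda>h. inv\<^bsub>H\<^esub> h) ` U) \<times> {inv\<^bsub>C\<^esub> x}" using xU by force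
    also have "\<dots> \<in> S" using xU inv unfolding S_def by blast
    finally show ?thesis .
  qed
  ultimately show ?thesis
    unfolding S_ring_def using S one_S span by auto
qed

section \<open>The dihedral group of order 8 in normal form, and its four partitions\<close>

lemma sum_lessThan_4_2:
  fixes F :: "nat \<Rightarrow> nat \<Rightarrow> int"
  shows "(\<Sum>j<4. \<Sum>t<2. F j t) =
    F 0 0 + F 0 1 + F 1 0 + F 1 1 + F 2 0 + F 2 1 + F 3 0 + F 3 1"
  by (simp add: numeral_eq_Suc)

locale dihedral8 = group H for H (structure) +
  fixes a b
  assumes a_closed [simp]: "a \<in> carrier H" and b_closed [simp]: "b \<in> carrier H"
    and generated: "carrier H = generate H {a, b}"
    and a_pow4: "a [^] (4::nat) = \<one>" and b_pow2: "b [^] (2::nat) = \<one>"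
    and conj: "inv b \<otimes> a \<otimes> b = inv a"
    and order8: "order H = 8"
begin

definition el :: "nat \<Rightarrow> nat \<Rightarrow> 'a" where
  "el i s = a [^] i \<otimes> b [^] s"

lemma el_closed [simp]: "el i s \<in> carrier H"
  by (simp add: el_def)

text \<open>The exponent 3 plays the role of -1 modulo 4, which keeps all exponents natural
  numbers.\<close>

lemma b_mult_a: "b \<otimes> a = a [^] (3::nat) \<otimes> b"
proof -
  have bb: "b \<otimes> b = \<one>" using b_pow2 by (simp add: numeral_2_eq_2)
  then have "inv b = b" by (simp add: inv_equality)
  moreover have "inv a = a [^] (3::nat)"
    using a_pow4 by (intro inv_equality) (simp_all flip: nat_pow_Suc)
  ultimately have "b \<otimes> a \<otimes> b \<otimes> b = a [^] (3::nat) \<otimes> b" using conj by simp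
  then show ?thesis by (simp add: m_assoc bb)
qed

lemma b_mult_a_pow: "b \<otimes> a [^] i = a [^] (3 * i) \<otimes> b" for i :: nat
proof (induction i)
  case (Suc i)
  have "b \<otimes> a [^] Suc i = a [^] (3 * i) \<otimes> (b \<otimes> a)"
    using Suc by (simp add: m_assoc[symmetric])
  also have "\<dots> = a [^] (3 * i) \<otimes> a [^] (3::nat) \<otimes> b"
    by (simp add: b_mult_a m_assoc)
  also have "\<dots> = a [^] (3 * Suc i) \<otimes> b"
    by (simp add: nat_pow_mult add.commute)
  finally show ?case .
qed simp

lemma b_pow_mult_a_pow: "b [^] s \<otimes> a [^] i = a [^] (3 ^ s * i) \<otimes> b [^] s" for i s :: nat
proof (induction s arbitrary: i)
  case (Suc s)
  have "b [^] Suc s \<otimes> a [^] i = b [^] s \<otimes> a [^] (3 * i) \<otimes> b"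
    by (simp add: m_assoc b_mult_a_pow)
  then show ?case by (simp add: Suc m_assoc mult.assoc mult.left_commute)
qed simp

lemma el_mod: "el (i mod 4) (s mod 2) = el i s"
proof -
  have "a [^] i = a [^] (4 * (i div 4) + i mod 4)" by simp
  also have "\<dots> = a [^] (i mod 4)"
    by (simp only: nat_pow_mult[symmetric] nat_pow_pow[symmetric] a_closed a_pow4) simp
  finally have i: "a [^] i = a [^] (i mod 4)" .
  have "b [^] s = b [^] (2 * (s div 2) + s mod 2)" by simp
  also have "\<dots> = b [^] (s mod 2)"
    by (simp only: nat_pow_mult[symmetric] nat_pow_pow[symmetric] b_closed b_pow2) simp
  finally show ?thesis using i by (simp add: el_def)
qed

lemma el_mult: "el i s \<otimes> el j t = el ((i + 3 ^ s * j) mod 4) ((s + t) mod 2)"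
proof -
  have "el i s \<otimes> el j t = a [^] i \<otimes> (b [^] s \<otimes> a [^] j) \<otimes> b [^] t"
    by (simp add: el_def m_assoc)
  also have "\<dots> = el (i + 3 ^ s * j) (s + t)"
    by (simp add: el_def b_pow_mult_a_pow m_assoc nat_pow_mult)
      (simp add: m_assoc[symmetric] nat_pow_mult)
  finally show ?thesis by (simp add: el_mod)
qed

lemma el_0_0: "el 0 0 = \<one>"
  by (simp add: el_def)

text \<open>The inverse of a^i b^s is b^s a^(-i), whose normal form has the a-exponent -(-1)^s i.
  With 3 in place of -1 this is 3^(s+1) i modulo 4.\<close>

lemma el_inv: "inv (el i s) = el ((3 ^ Suc s * i) mod 4) (s mod 2)"
proof (rule inv_equality)
  have "(3 ^ Suc s * i + 3 ^ s * i) mod 4 = 0" by simp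
  then have "el (3 ^ Suc s * i) s \<otimes> el i s = \<one>"
    by (simp add: el_mult el_0_0 flip: mult_2)
  then show "el (3 ^ Suc s * i mod 4) (s mod 2) \<otimes> el i s = \<one>" by (simp only: el_mod)
qed auto

text \<open>The normal forms contain both generators and are closed under products and inverses, so
  they form a subgroup that must be everything.\<close>

lemma carrier_eq_image: "carrier H = (\<lambda>(i, s). el i s) ` ({..<4} \<times> {..<2})" (is "_ = ?E")
proof
  have mem: "el i s \<in> ?E" for i s
    by (rule image_eqI[of _ _ "(i mod 4, s mod 2)"]) (auto simp: el_mod)
  have "subgroup ?E H"
  proof (rule subgroupI)
    show "?E \<noteq> {}" using mem by blast
  qed (use mem in \<open>auto simp: el_mult el_inv\<close>)
  moreover have "{a, b} \<subseteq> ?E"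
    using mem[of 1 0] mem[of 0 1] by (simp add: el_def)
  ultimately show "carrier H \<subseteq> ?E"
    unfolding generated by (rule generate_subgroup_incl[rotated])
qed auto

lemma finite_carrier: "finite (carrier H)"
  by (simp add: carrier_eq_image)

text \<open>Eight index pairs map onto a group of order 8, so no two of them coincide. The relations
  by themselves also hold in proper quotients; \<open>order8\<close> excludes these.\<close>

lemma inj_el: "inj_on (\<lambda>(i, s). el i s) ({..<4} \<times> {..<2})"
  using order8 by (intro eq_card_imp_inj_on) (simp_all add: order_def carrier_eq_image)

lemma el_eq_iff:
  "i < 4 \<Longrightarrow> j < 4 \<Longrightarrow> s < 2 \<Longrightarrow> t < 2 \<Longrightarrow> el i s = el j t \<longleftrightarrow> i = j \<and> s = t"
  using inj_onD[OF inj_el, of "(i, s)" "(j, t)"] by auto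

lemma carrier_eq:
  "carrier H = {el 0 0, el 1 0, el 2 0, el 3 0, el 0 1, el 1 1, el 2 1, el 3 1}"
proof -
  have "{..<4::nat} = {0, 1, 2, 3}" "{..<2::nat} = {0, 1}" by auto
  then show ?thesis unfolding carrier_eq_image by (simp add: insert_commute)
qed

text \<open>The indices are left as \<open>el_inv\<close> and \<open>el_mult\<close> produce them.
  For numerals they evaluate to normal-form indices, so together with
  \<open>sum_lessThan_4_2\<close> each coefficient of a product becomes an explicit sum of eight
  terms.\<close>

lemma mult_el:
  assumes "i < 4" "s < 2"
  shows "(f \<otimes>\<^bsub>group_ring H\<^esub> g) (el i s) =
    (\<Sum>j<4. \<Sum>t<2.
      f (el j t) * g (el ((3 ^ Suc t * j mod 4 + 3 ^ (t mod 2) * i) mod 4) ((t mod 2 + s) mod 2)))"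
proof -
  have "(f \<otimes>\<^bsub>group_ring H\<^esub> g) (el i s) =
      (\<Sum>k\<in>carrier H. f k * g (inv k \<otimes> el i s))"
    by (simp add: group_ring_def)
  also have "\<dots> = (\<Sum>(j, t)\<in>{..<4} \<times> {..<2}. f (el j t) * g (inv (el j t) \<otimes> el i s))"
    unfolding carrier_eq_image using inj_el
    by (subst sum.reindex) (auto simp: case_prod_unfold)
  finally show ?thesis by (simp only: sum.cartesian_product el_inv el_mult)
qed

text \<open>The partitions of \<open>H\<close> induced on the fibres over \<open>e\<close>, \<open>c\<close>, \<open>c\<^sup>-\<^sup>1\<close> and \<open>c\<^sup>k\<close> respectively.\<close>

definition part_one :: "'a set set" where
  "part_one = {{el 0 0}, {el 2 0}, {el 1 1}, {el 3 1}, {el 1 0, el 3 0, el 0 1, el 2 1}}"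

definition part_gen :: "'a set set" where
  "part_gen = {{el 0 0, el 2 0}, {el 1 1, el 3 1}, {el 1 0, el 0 1}, {el 3 0, el 2 1}}"

definition part_inv :: "'a set set" where
  "part_inv = {{el 0 0, el 2 0}, {el 1 1, el 3 1}, {el 3 0, el 0 1}, {el 1 0, el 2 1}}"

definition part_pow :: "'a set set" where
  "part_pow = {{el 0 0, el 2 0}, {el 1 1, el 3 1}, {el 1 0, el 3 0, el 0 1, el 2 1}}"

lemmas part_defs = part_one_def part_gen_def part_inv_def part_pow_def

lemma partition_on_parts:
  "partition_on (carrier H) part_one" "partition_on (carrier H) part_gen"
  "partition_on (carrier H) part_inv" "partition_on (carrier H) part_pow"
  unfolding partition_on_def part_defs carrier_eq
  by (simp_all add: disjoint_def el_eq_iff insert_commute)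

lemma image_inv_parts:
  "U \<in> part_one \<Longrightarrow> (\<lambda>h. inv h) ` U \<in> part_one"
  "U \<in> part_gen \<Longrightarrow> (\<lambda>h. inv h) ` U \<in> part_inv"
  "U \<in> part_inv \<Longrightarrow> (\<lambda>h. inv h) ` U \<in> part_gen"
  "U \<in> part_pow \<Longrightarrow> (\<lambda>h. inv h) ` U \<in> part_pow"
  unfolding part_defs
  by (elim insertE emptyE; simp add: el_inv insert_commute flip: numeral_2_eq_2 numeral_3_eq_3)+

section \<open>Products of the four submodules in the group ring of \<open>H\<close>\<close>

text \<open>Every equation points to a fixed representative of its block, so these conditions can
  act as rewrite rules on the values of \<open>f\<close> and \<open>g\<close> in the product
  computations below.\<close>

lemma block_const_parts:
  "block_const part_one f \<longleftrightarrow>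
    f (el 3 0) = f (el 1 0) \<and> f (el 0 1) = f (el 1 0) \<and> f (el 2 1) = f (el 1 0)"
  "block_const part_gen f \<longleftrightarrow> f (el 2 0) = f (el 0 0) \<and> f (el 3 1) = f (el 1 1) \<and>
    f (el 0 1) = f (el 1 0) \<and> f (el 2 1) = f (el 3 0)"
  "block_const part_inv f \<longleftrightarrow> f (el 2 0) = f (el 0 0) \<and> f (el 3 1) = f (el 1 1) \<and>
    f (el 0 1) = f (el 3 0) \<and> f (el 2 1) = f (el 1 0)"
  "block_const part_pow f \<longleftrightarrow> f (el 2 0) = f (el 0 0) \<and> f (el 3 1) = f (el 1 1) \<and>
    f (el 3 0) = f (el 1 0) \<and> f (el 0 1) = f (el 1 0) \<and> f (el 2 1) = f (el 1 0)"
  unfolding block_const_def part_defs by (simp_all only: ball_simps simp_thms) metis+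

text \<open>Each block of \<open>part_pow\<close> is a union of blocks of each of the other three
  partitions.\<close>

lemma block_const_part_pow_imp:
  assumes "block_const part_pow f"
  shows "block_const part_one f" "block_const part_gen f" "block_const part_inv f"
  using assms by (auto simp: block_const_parts)

text \<open>Let V be the Klein four-group {e, a^2, ab, a^3b} and R its complement, the last block of
  \<open>part_one\<close>. Left multiplication by an element of V permutes the blocks of each
  partition. Every block U lies in V or in R, so R times U is |U| times R or V, which is constant on
  all blocks.\<close>

lemma mult_part_one:
  assumes "block_const part_one f"
  shows "block_const part_one g \<Longrightarrow> block_const part_one (f \<otimes>\<^bsub>group_ring H\<^esub> g)"
    and "block_const part_gen g \<Longrightarrow> block_const part_gen (f \<otimes>\<^bsub>group_ring H\<^esub> g)"
    and "block_const part_inv g \<Longrightarrow> block_const part_inv (f \<otimes>\<^bsub>group_ring H\<^esub> g)"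
    and "block_const part_pow g \<Longrightarrow> block_const part_pow (f \<otimes>\<^bsub>group_ring H\<^esub> g)"
  using assms by (simp_all add: block_const_parts mult_el sum_lessThan_4_2 algebra_simps
    flip: numeral_2_eq_2 numeral_3_eq_3)

text \<open>The two kinds of inner products differ on blocks outside V = {e, a^2, ab, a^3b}:
  {a,b}{a,b} is V, but {a,b}{a^3,b} is 2e + 2ab. The latter is why the fibre over the identity has
  to separate the elements of V.\<close>

lemma mult_part_gen:
  assumes "block_const part_gen f"
  shows "block_const part_one g \<Longrightarrow> block_const part_gen (f \<otimes>\<^bsub>group_ring H\<^esub> g)"
    and "block_const part_gen g \<Longrightarrow> block_const part_pow (f \<otimes>\<^bsub>group_ring H\<^esub> g)"
    and "block_const part_inv g \<Longrightarrow> block_const part_one (f \<otimes>\<^bsub>group_ring H\<^esub> g)"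
    and "block_const part_pow g \<Longrightarrow> block_const part_pow (f \<otimes>\<^bsub>group_ring H\<^esub> g)"
  using assms by (simp_all add: block_const_parts mult_el sum_lessThan_4_2 algebra_simps
    flip: numeral_2_eq_2 numeral_3_eq_3)

text \<open>The factors do not commute: {a^3,b}{a,b} is 2e + 2a^3b, whereas the opposite order gives
  2e + 2ab. Both orders therefore need their own check.\<close>

lemma mult_part_inv:
  assumes "block_const part_inv f"
  shows "block_const part_one g \<Longrightarrow> block_const part_inv (f \<otimes>\<^bsub>group_ring H\<^esub> g)"
    and "block_const part_gen g \<Longrightarrow> block_const part_one (f \<otimes>\<^bsub>group_ring H\<^esub> g)"
    and "block_const part_inv g \<Longrightarrow> block_const part_pow (f \<otimes>\<^bsub>group_ring H\<^esub> g)"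
    and "block_const part_pow g \<Longrightarrow> block_const part_pow (f \<otimes>\<^bsub>group_ring H\<^esub> g)"
  using assms by (simp_all add: block_const_parts mult_el sum_lessThan_4_2 algebra_simps
    flip: numeral_2_eq_2 numeral_3_eq_3)

text \<open>Absorption holds because a two-element block outside the Klein four-group, such as
  {a,b}, has one element in each of the two cosets of {e, a^2} there. Multiplying it by {e, a^2} or
  {ab, a^3b} yields the whole block {a, a^3, b, a^2b}.\<close>

lemma mult_part_pow:
  assumes "block_const part_pow f"
  shows "block_const part_one g \<Longrightarrow> block_const part_pow (f \<otimes>\<^bsub>group_ring H\<^esub> g)"
    and "block_const part_gen g \<Longrightarrow> block_const part_pow (f \<otimes>\<^bsub>group_ring H\<^esub> g)"
    and "block_const part_inv g \<Longrightarrow> block_const part_pow (f \<otimes>\<^bsub>group_ring H\<^esub> g)"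
    and "block_const part_pow g \<Longrightarrow> block_const part_pow (f \<otimes>\<^bsub>group_ring H\<^esub> g)"
  using assms by (simp_all add: block_const_parts mult_el sum_lessThan_4_2 algebra_simps
    flip: numeral_2_eq_2 numeral_3_eq_3)

section \<open>Assembly over the cyclic group of order p\<close>

definition fibre_part :: "('c, 'n) monoid_scheme \<Rightarrow> 'c \<Rightarrow> 'c \<Rightarrow> 'a set set" where
  "fibre_part C c x =
    (if x = \<one>\<^bsub>C\<^esub> then part_one else if x = c then part_gen
     else if x = inv\<^bsub>C\<^esub> c then part_inv else part_pow)"

text \<open>Brings the explicit list of basic sets into the shape required by
  \<open>S_ring_fibrewise\<close>. The inequalities ensure that no test in \<open>fibre_part\<close>
  shadows a later one.\<close>

lemma basic_sets_eq:
  assumes "inv\<^bsub>C\<^esub> c \<noteq> c" "c \<noteq> \<one>\<^bsub>C\<^esub>" "inv\<^bsub>C\<^esub> c \<noteq> \<one>\<^bsub>C\<^esub>"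
    and "(\<lambda>k::nat. c [^]\<^bsub>C\<^esub> k) ` {2..p - 2} = carrier C - {\<one>\<^bsub>C\<^esub>, c, inv\<^bsub>C\<^esub> c}"
    and "{\<one>\<^bsub>C\<^esub>, c, inv\<^bsub>C\<^esub> c} \<subseteq> carrier C"
  shows "basic_sets H a b C c p = (\<Union>x\<in>carrier C. (\<lambda>U. U \<times> {x}) ` fibre_part C c x)"
proof -
  have el: "el 0 0 = \<one>" "el 1 0 = a" "el 0 1 = b"
    "el 2 0 = a [^] (2::nat)" "el 3 0 = a [^] (3::nat)"
    "el 1 1 = a \<otimes> b" "el 2 1 = a [^] (2::nat) \<otimes> b" "el 3 1 = a [^] (3::nat) \<otimes> b"
    by (simp_all add: el_def)
  let ?N = "carrier C - {\<one>\<^bsub>C\<^esub>, c, inv\<^bsub>C\<^esub> c}"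
  have pow: "(\<Union>k\<in>{2..p - 2}.
      {{el 0 0, el 2 0} \<times> {c [^]\<^bsub>C\<^esub> k}, {el 1 1, el 3 1} \<times> {c [^]\<^bsub>C\<^esub> k},
       {el 1 0, el 3 0, el 0 1, el 2 1} \<times> {c [^]\<^bsub>C\<^esub> k}}) =
    (\<Union>x\<in>?N. (\<lambda>U. U \<times> {x}) ` part_pow)"
    unfolding assms(4)[symmetric] by (simp add: part_pow_def)
  have "basic_sets H a b C c p =
      (\<lambda>U. U \<times> {\<one>\<^bsub>C\<^esub>}) ` part_one \<union> (\<lambda>U. U \<times> {c}) ` part_gen \<union>
      (\<lambda>U. U \<times> {inv\<^bsub>C\<^esub> c}) ` part_inv \<union> (\<Union>x\<in>?N. (\<lambda>U. U \<times> {x}) ` part_pow)"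
    unfolding pow[symmetric]
    unfolding basic_sets_def Let_def part_defs image_insert image_empty el ..
  also have "\<dots> = (\<Union>x\<in>{\<one>\<^bsub>C\<^esub>, c, inv\<^bsub>C\<^esub> c} \<union> ?N. (\<lambda>U. U \<times> {x}) ` fibre_part C c x)"
    unfolding UN_Un using assms(1-3) by (simp add: fibre_part_def Un_assoc)
  also have "{\<one>\<^bsub>C\<^esub>, c, inv\<^bsub>C\<^esub> c} \<union> ?N = carrier C" using assms(5) by blast
  finally show ?thesis .
qed

end

text \<open>The exponents 0, ..., p - 1 enumerate the group without repetition. The identity,
  \<open>c\<close> and \<open>inv c\<close> have exponents 0, 1 and p - 1, and deleting these leaves
  2, ..., p - 2.\<close>

lemma (in group) cyclic_generator_powers:
  assumes c: "c \<in> carrier G" and gen: "carrier G = generate G {c}" and ord: "order G = p" "p \<ge> 3"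
  shows "c \<noteq> \<one>" "inv c \<noteq> c"
    and "(\<lambda>k::nat. c [^] k) ` {2..p - 2} = carrier G - {\<one>, c, inv c}"
proof -
  have fin: "finite (carrier G)"
    using ord by (metis card.infinite not_numeral_le_zero order_def)
  have o: "ord c = p"
    using generate_pow_card[OF c] gen ord by (simp add: order_def)
  have inj: "inj_on (\<lambda>k::nat. c [^] k) {0..p - 1}" using ord_inj[OF c] o by simp
  have "c [^] (p - 1) \<otimes> c = c [^] p"
    using ord(2) by (simp flip: nat_pow_Suc)
  then have inv: "inv c = c [^] (p - 1)"
    using c o pow_ord_eq_1[OF c] by (intro inv_equality) auto
  have "carrier G = (\<lambda>k::nat. c [^] k) ` {0..p - 1}"
  proof (rule card_subset_eq[symmetric])
    show "card ((\<lambda>k::nat. c [^] k) ` {0..p - 1}) = card (carrier G)"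
      using inj ord by (simp add: card_image order_def)
  qed (use c fin in auto)
  moreover have "{2..p - 2} = {0..p - 1} - {0, 1, p - 1}" using ord(2) by auto
  ultimately show "(\<lambda>k::nat. c [^] k) ` {2..p - 2} = carrier G - {\<one>, c, inv c}"
    using inj_on_image_set_diff[OF inj, of "{0..p - 1}" "{0, 1, p - 1}"] ord(2) c
    by (simp add: inv)
  show "c \<noteq> \<one>" using inj_onD[OF inj, of 0 1] c ord(2) by force
  show "inv c \<noteq> c" using inj_onD[OF inj, of "p - 1" 1] c ord(2) by (force simp: inv)
qed

theorem lemma3p2:
  fixes H :: "('h, 'm) monoid_scheme" and C :: "('c, 'n) monoid_scheme"
    and a b :: 'h and c :: 'c and p :: nat
  assumes "prime p" and "p \<ge> 5"
    and "group H" and "a \<in> carrier H" and "b \<in> carrier H"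
    and "carrier H = generate H {a, b}"
    and "a [^]\<^bsub>H\<^esub> (4::nat) = \<one>\<^bsub>H\<^esub>" and "b [^]\<^bsub>H\<^esub> (2::nat) = \<one>\<^bsub>H\<^esub>"
    and "inv\<^bsub>H\<^esub> b \<otimes>\<^bsub>H\<^esub> a \<otimes>\<^bsub>H\<^esub> b = inv\<^bsub>H\<^esub> a"
    and "order H = 8"
    and "group C" and "c \<in> carrier C"
    and "carrier C = generate C {c}"
    and "order C = p"
  shows "partition_on (carrier (H \<times>\<times> C)) (basic_sets H a b C c p) \<and>
    S_ring (H \<times>\<times> C) (int_span (simple_quantity ` basic_sets H a b C c p))"
proof -
  interpret dihedral8 H a b
    using assms by (simp add: dihedral8_def dihedral8_axioms_def)
  interpret C: group C by fact
  note c = \<open>c \<in> carrier C\<close>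
  have fin: "finite (carrier C)"
    using assms(2,14) by (metis card.infinite not_numeral_le_zero order_def)
  have p3: "p \<ge> 3" using \<open>p \<ge> 5\<close> by simp
  note gen = C.cyclic_generator_powers[OF c assms(13,14) p3]
  have inv1: "inv\<^bsub>C\<^esub> c \<noteq> \<one>\<^bsub>C\<^esub>" using gen(1) c by (simp add: C.inv_eq_1_iff)
  let ?P = "fibre_part C c"
  have basic: "basic_sets H a b C c p = (\<Union>x\<in>carrier C. (\<lambda>U. U \<times> {x}) ` ?P x)"
    using gen inv1 c by (intro basic_sets_eq) auto
  have part: "partition_on (carrier H) (?P x)" for x
    by (simp add: fibre_part_def partition_on_parts)
  have P: "?P \<one>\<^bsub>C\<^esub> = part_one" "?P c = part_gen" "?P (inv\<^bsub>C\<^esub> c) = part_inv"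
    using gen inv1 by (auto simp: fibre_part_def)
  have pow_imp: "block_const (?P x) f" if "block_const part_pow f" for x f
    using that block_const_part_pow_imp by (simp add: fibre_part_def)
  have "S_ring (H \<times>\<times> C) (int_span (simple_quantity ` (\<Union>x\<in>carrier C. (\<lambda>U. U \<times> {x}) ` ?P x)))"
  proof (rule S_ring_fibrewise)
    show "{\<one>\<^bsub>H\<^esub>} \<in> ?P \<one>\<^bsub>C\<^esub>" by (simp add: P part_one_def el_0_0)
  next
    fix x U assume x: "x \<in> carrier C" and U: "U \<in> ?P x"
    consider "x = \<one>\<^bsub>C\<^esub>" | "x = c" | "x = inv\<^bsub>C\<^esub> c" | "x \<notin> {\<one>\<^bsub>C\<^esub>, c, inv\<^bsub>C\<^esub> c}" by blast
    then show "(\<lambda>h. inv\<^bsub>H\<^esub> h) ` U \<in> ?P (inv\<^bsub>C\<^esub> x)"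
    proof cases
      case 4
      \<comment> \<open>The complement of the three special elements is closed under inversion, so
        \<open>x\<close> and its inverse both carry \<open>part_pow\<close>.\<close>
      then have "inv\<^bsub>C\<^esub> x \<notin> {\<one>\<^bsub>C\<^esub>, c, inv\<^bsub>C\<^esub> c}"
        using x c by (auto simp: C.inv_eq_1_iff dest: C.inv_inv)
      with 4 U show ?thesis by (auto simp: fibre_part_def intro: image_inv_parts)
    qed (use U c in \<open>auto simp: P intro: image_inv_parts\<close>)
  next
    fix x y f g
    assume x: "x \<in> carrier C" and y: "y \<in> carrier C"
      and f: "block_const (?P x) f" and g: "block_const (?P y) g"
    consider "x = \<one>\<^bsub>C\<^esub>" | "y = \<one>\<^bsub>C\<^esub>" | "x = c" "y = inv\<^bsub>C\<^esub> c" | "x = inv\<^bsub>C\<^esub> c" "y = c"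
      | "x \<noteq> \<one>\<^bsub>C\<^esub>" "y \<noteq> \<one>\<^bsub>C\<^esub>" "\<not> (x = c \<and> y = inv\<^bsub>C\<^esub> c)" "\<not> (x = inv\<^bsub>C\<^esub> c \<and> y = c)" by blast
    then show "block_const (?P (x \<otimes>\<^bsub>C\<^esub> y)) (f \<otimes>\<^bsub>group_ring H\<^esub> g)"
    proof cases
      case 1
      then show ?thesis
        using f g y mult_part_one by (simp add: P) (simp add: fibre_part_def split: if_splits)
    next
      case 2
      then show ?thesis
        using f g x mult_part_one(1) mult_part_gen(1) mult_part_inv(1) mult_part_pow(1)
        by (simp add: P) (simp add: fibre_part_def split: if_splits)
    next
      case 3
      then show ?thesis using f g c mult_part_gen(3) by (simp add: P)
    next
      case 4
      then show ?thesis using f g c mult_part_inv(2) by (simp add: P)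
    next
      \<comment> \<open>This includes x = y = c and x = y = \<open>inv c\<close>. Every such product
        lies in the submodule of \<open>part_pow\<close>, which is contained in all the others, so
        it need not be known which element of \<open>C\<close> the product of \<open>x\<close> and
        \<open>y\<close> is.\<close>
      case 5
      then have "block_const part_pow (f \<otimes>\<^bsub>group_ring H\<^esub> g)"
        using f g mult_part_gen(2,4) mult_part_inv(3,4) mult_part_pow(2-4)
        by (simp add: fibre_part_def split: if_splits)
      then show ?thesis by (rule pow_imp)
    qed
  qed (use assms fin finite_carrier part in auto)
  then show ?thesis
    using partition_on_fibrewise[of "carrier C" "carrier H" ?P] part by (simp add: basic DirProd_def)
qed

end
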